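(* Let $G$ be a finite connected graph of order $n\geq 2$ and minimum degree $\delta(G)$. Then $\rho_{o}(G)=\frac{n}{\delta(G)}$ if and only if $G\in\Gamma$.
   Context: For a vertex $v$, $N(v)$ is its open neighbourhood. A set $B\subseteq V(G)$ is an open packing if $N(u)\cap N(v)=\emptyset$ for all distinct $u,v\in B$; $\rho_o(G)$ is the maximum cardinality of an open packing in $G$. The family $\Gamma$ consists of all graphs $G$ constructed as follows: choose integers $t\geq 1$ and $k\geq 0$; let $H$ be the disjoint union of $t$ copies of $K_2$; for each vertex $u$ of $H$ add a set $pn(u)$ of $k$ new vertices, each joined to $u$ only (the sets $pn(u)$ pairwise disjoint and disjoint from $V(H)$); then add edges only among vertices of $\bigcup_{u\in V(H)}pn(u)$ so that the resulting graph $G$ on $V(H)\cup\bigcup_{u\in V(H)}pn(u)$ is connected and every vertex $v\in\bigcup_{u\in V(H)}pn(u)$ has $\deg(v)\geq k+1$. (Then each vertex of $H$ has degree $\delta(G)=k+1$ and each vertex outside $V(H)$ has exactly one neighbour in $V(H)$.) *)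

theory Defs
  imports "Graph_Theory.Graph_Theory" "HOL-Library.Disjoint_Sets"
begin

text \<open>
  A finite simple graph is a \<^locale>\<open>pair_graph\<close>: a finite symmetric loopfree digraph whose arcs
  are ordered pairs. Each undirected edge is a pair of opposite arcs, so the degree of a vertex is
  its out-degree.
\<close>

definition open_nbhd :: "'a pair_pre_digraph \<Rightarrow> 'a \<Rightarrow> 'a set" where
  "open_nbhd G v = {w. (v, w) \<in> parcs G}"

definition min_degree :: "'a pair_pre_digraph \<Rightarrow> nat" where
  "min_degree G = Min (out_degree (with_proj G) ` pverts G)"

definition open_packing :: "'a pair_pre_digraph \<Rightarrow> 'a set \<Rightarrow> bool" where
  "open_packing G B \<longleftrightarrow> B \<subseteq> pverts G \<and>
     (\<forall>u\<in>B. \<forall>v\<in>B. u \<noteq> v \<longrightarrow> open_nbhd G u \<inter> open_nbhd G v = {})"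

definition open_packing_number :: "'a pair_pre_digraph \<Rightarrow> nat" where
  "open_packing_number G = Max (card ` {B. open_packing G B})"

definition disjoint_K2s :: "nat \<Rightarrow> 'a pair_pre_digraph \<Rightarrow> bool" where
  "disjoint_K2s t H \<longleftrightarrow> (\<exists>C.
     (\<forall>i<t. complete_digraph 2 (with_proj (C i))) \<and>
     disjoint_family_on (\<lambda>i. pverts (C i)) {..<t} \<and>
     H = \<lparr> pverts = (\<Union>i<t. pverts (C i)), parcs = (\<Union>i<t. parcs (C i)) \<rparr>)"

text \<open>
  In the following, \<open>P\<close> is the set of all added vertices and \<open>F\<close> the set of edges added among them.
  Finiteness of \<open>pn u\<close> is required explicitly because an infinite set has cardinality 0. The
  vertices are arbitrary elements of the type, so the family is closed under isomorphism.
\<close>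

definition Gamma_family :: "'a pair_pre_digraph set" where
  "Gamma_family = {G. \<exists>t k H pn P F.
     t \<ge> 1 \<and> disjoint_K2s t H \<and>
     (\<forall>u\<in>pverts H. finite (pn u) \<and> card (pn u) = k \<and> pn u \<inter> pverts H = {}) \<and>
     disjoint_family_on pn (pverts H) \<and>
     P = (\<Union>u\<in>pverts H. pn u) \<and>
     F \<subseteq> P \<times> P \<and> sym F \<and> irrefl F \<and>
     G = \<lparr> pverts = pverts H \<union> P,
           parcs = parcs H \<union> (\<Union>u\<in>pverts H. {u} \<times> pn u \<union> pn u \<times> {u}) \<union> F \<rparr> \<and>
     connected (with_proj G) \<and>
     (\<forall>v\<in>P. out_degree (with_proj G) v \<ge> k + 1)}"

end

theory Submission
  imports Defs
begin

text \<open>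
  The neighbourhoods of the members of an open packing \<open>B\<close> are pairwise disjoint subsets of the
  vertex set, so \<open>|B| \<cdot> \<delta> \<le> \<Sum>\<^sub>u\<^sub>\<in>\<^sub>B deg u \<le> n\<close>. Equality means that all members of \<open>B\<close> have degree
  \<open>\<delta>\<close> and that every vertex has exactly one neighbour in \<open>B\<close>. In particular \<open>B\<close> induces a perfect
  matching and the remaining neighbours of its members partition the other vertices, which is the
  structure of a graph in \<open>\<Gamma>\<close>. Conversely, in a graph of \<open>\<Gamma>\<close> the vertices of the copies of \<open>K\<^sub>2\<close>
  form an open packing whose neighbourhoods cover everything.
\<close>

section \<open>Degrees, open packings and the counting bound\<close>

lemma out_degree_eq_card_open_nbhd:
  "out_degree (with_proj G) v = card (open_nbhd G v)"
proof -
  have "out_arcs (with_proj G) v = Pair v ` open_nbhd G v"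
    by (auto simp: out_arcs_def open_nbhd_def)
  then show ?thesis
    by (simp add: out_degree_def card_image inj_on_def)
qed

context pair_graph
begin

lemma open_nbhd_subset: "open_nbhd G v \<subseteq> pverts G"
  by (auto simp: open_nbhd_def dest: in_arcsD2)

lemma finite_open_nbhd: "finite (open_nbhd G v)"
  using open_nbhd_subset pair_finite_verts by (rule finite_subset)

lemma parcs_sym: "(u, v) \<in> parcs G \<longleftrightarrow> (v, u) \<in> parcs G"
  using pair_sym_arcs by (auto simp: symmetric_def dest: symD)

lemma min_degree_le:
  "v \<in> pverts G \<Longrightarrow> min_degree G \<le> card (open_nbhd G v)"
  using pair_finite_verts
  by (auto simp: min_degree_def out_degree_eq_card_open_nbhd intro!: Min_le)

lemma finite_open_packing: "open_packing G B \<Longrightarrow> finite B"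
  using pair_finite_verts by (auto simp: open_packing_def intro: finite_subset)

lemma finite_open_packings: "finite {B. open_packing G B}"
  by (rule finite_subset[of _ "Pow (pverts G)"])
    (auto simp: open_packing_def pair_finite_verts)

lemma card_le_open_packing_number:
  "open_packing G B \<Longrightarrow> card B \<le> open_packing_number G"
  using finite_open_packings by (auto simp: open_packing_number_def intro!: Max_ge)

lemma open_packing_number_attained:
  obtains B where "open_packing G B" "card B = open_packing_number G"
proof -
  \<comment> \<open>The empty packing shows that the \<open>Max\<close> ranges over a nonempty
    set.\<close>
  have "open_packing G {}"
    by (simp add: open_packing_def)
  then have "open_packing_number G \<in> card ` {B. open_packing G B}"
    unfolding open_packing_number_def using finite_open_packings by (intro Max_in) auto
  then show thesis
    using that by auto
qed

lemma open_packing_sum_degrees: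
  assumes "open_packing G B"
  shows "(\<Sum>u\<in>B. card (open_nbhd G u)) = card (\<Union>u\<in>B. open_nbhd G u)"
  using assms finite_open_nbhd finite_open_packing[OF assms]
  by (subst card_UN_disjoint) (auto simp: open_packing_def)

lemma open_packing_degree_sum_bounds:
  assumes "open_packing G B"
  shows "card B * min_degree G \<le> (\<Sum>u\<in>B. card (open_nbhd G u))"
    and "(\<Sum>u\<in>B. card (open_nbhd G u)) \<le> card (pverts G)"
proof -
  have "(\<Sum>u\<in>B. min_degree G) \<le> (\<Sum>u\<in>B. card (open_nbhd G u))"
    using assms by (intro sum_mono min_degree_le) (auto simp: open_packing_def)
  then show "card B * min_degree G \<le> (\<Sum>u\<in>B. card (open_nbhd G u))"
    by simp
  show "(\<Sum>u\<in>B. card (open_nbhd G u)) \<le> card (pverts G)"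
    unfolding open_packing_sum_degrees[OF assms]
    using pair_finite_verts open_nbhd_subset by (intro card_mono) auto
qed

lemma open_packing_number_mult_min_degree_le:
  "open_packing_number G * min_degree G \<le> card (pverts G)"
  using open_packing_number_attained open_packing_degree_sum_bounds by (metis le_trans)

text \<open>By \<open>tight\<close> the outer terms of the two bounds in
  \<open>open_packing_degree_sum_bounds\<close> agree, so both bounds are equalities. The first
  leaves no member of \<open>B\<close> a larger degree; the second makes the neighbourhoods cover
  the vertex set.\<close>

lemma tight_open_packing:
  assumes B: "open_packing G B" and tight: "card B * min_degree G = card (pverts G)"
  shows "u \<in> B \<Longrightarrow> card (open_nbhd G u) = min_degree G"
    and "v \<in> pverts G \<Longrightarrow> \<exists>!u. u \<in> B \<and> (u, v) \<in> parcs G"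
proof -
  note bounds = open_packing_degree_sum_bounds[OF B]
  show "card (open_nbhd G u) = min_degree G" if "u \<in> B"
  proof (rule ccontr)
    assume "card (open_nbhd G u) \<noteq> min_degree G"
    moreover have le: "\<forall>u\<in>B. min_degree G \<le> card (open_nbhd G u)"
      using B min_degree_le by (auto simp: open_packing_def)
    ultimately have "(\<Sum>u\<in>B. min_degree G) < (\<Sum>u\<in>B. card (open_nbhd G u))"
      using that by (intro sum_strict_mono_ex1 finite_open_packing[OF B]) force+
    then show False
      using bounds tight by simp
  qed
  have "(\<Union>u\<in>B. open_nbhd G u) = pverts G"
    using bounds tight open_nbhd_subset open_packing_sum_degrees[OF B]
    by (intro card_subset_eq pair_finite_verts) auto
  \<comment> \<open>Covering gives existence, disjointness of the neighbourhoods gives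
    uniqueness.\<close>
  then show "\<exists>!u. u \<in> B \<and> (u, v) \<in> parcs G" if "v \<in> pverts G"
    using that B by (force simp: open_nbhd_def open_packing_def)
qed

end

section \<open>Disjoint copies of \<open>K_2\<close> and perfect matchings\<close>

text \<open>Reads a perfect matching off the indexed copies; vertex-disjointness confines the arcs
  at \<open>u\<close> to the one copy containing \<open>u\<close>.\<close>

lemma disjoint_K2s_matching:
  assumes "disjoint_K2s t H"
  shows "finite (pverts H)" "card (pverts H) = 2 * t"
    and "parcs H \<subseteq> pverts H \<times> pverts H"
    and "u \<in> pverts H \<Longrightarrow> \<exists>!v. (u, v) \<in> parcs H"
    and "(u, v) \<in> parcs H \<Longrightarrow> (v, u) \<in> parcs H"
proof -
  from assms obtain C where
      K: "\<And>i. i < t \<Longrightarrow> complete_digraph 2 (with_proj (C i))" and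
      disj: "disjoint_family_on (\<lambda>i. pverts (C i)) {..<t}" and
      H: "H = \<lparr> pverts = (\<Union>i<t. pverts (C i)), parcs = (\<Union>i<t. parcs (C i)) \<rparr>"
    unfolding disjoint_K2s_def by blast
  have C: "finite (pverts (C i))" "card (pverts (C i)) = 2"
      "parcs (C i) = {(u, v). (u, v) \<in> pverts (C i) \<times> pverts (C i) \<and> u \<noteq> v}" if "i < t" for i
    using K[OF that] by (simp_all add: complete_digraph_pair_def)
  show "finite (pverts H)"
    using C by (simp add: H)
  show "card (pverts H) = 2 * t"
    using C disj by (simp add: H card_UN_disjoint disjoint_family_on_def)
  show "parcs H \<subseteq> pverts H \<times> pverts H"
    using C by (auto simp: H)
  show "(v, u) \<in> parcs H" if "(u, v) \<in> parcs H"
    using that C by (auto simp: H)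
  show "\<exists>!v. (u, v) \<in> parcs H" if "u \<in> pverts H"
  proof -
    from that obtain i where i: "i < t" "u \<in> pverts (C i)"
      by (auto simp: H)
    obtain a b where ab: "pverts (C i) = {a, b}" "a \<noteq> b"
      using C(2)[OF i(1)] by (auto simp: card_2_iff)
    have "(u, v) \<in> parcs H \<longleftrightarrow> v \<in> {a, b} - {u}" for v
    proof
      assume "(u, v) \<in> parcs H"
      then obtain j where j: "j < t" "(u, v) \<in> parcs (C j)"
        by (auto simp: H)
      then have "j = i"
        using i disj C(3)[OF j(1)] by (auto simp: disjoint_family_on_def)
      then show "v \<in> {a, b} - {u}"
        using j C(3)[OF i(1)] ab by auto
    next
      assume "v \<in> {a, b} - {u}"
      then have "(u, v) \<in> parcs (C i)"
        using i ab C(3)[OF i(1)] by auto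
      then show "(u, v) \<in> parcs H"
        using i by (auto simp: H)
    qed
    then show ?thesis
      using i ab by auto
  qed
qed

text \<open>Conversely, the unordered edges of a perfect matching, numbered by a bijection
  \<open>h\<close>, serve as the vertex sets of the copies.\<close>

lemma matching_disjoint_K2s:
  assumes fin: "finite V" and E: "E \<subseteq> V \<times> V" "sym E" "irrefl E"
    and match: "\<And>u. u \<in> V \<Longrightarrow> \<exists>!v. (u, v) \<in> E"
  shows "\<exists>t. disjoint_K2s t \<lparr> pverts = V, parcs = E \<rparr>"
proof -
  \<comment> \<open>Both arcs of an edge yield the same set, so each edge gives a single
    copy.\<close>
  define S where "S = (\<lambda>(u, v). {u, v}) ` E"
  have "finite S"
    unfolding S_def using finite_subset[OF E(1)] fin by simp
  then obtain h where h: "bij_betw h {..<card S} S"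
    using ex_bij_betw_nat_finite by (metis atLeast0LessThan)
  define C where "C i = \<lparr> pverts = h i, parcs = {(u, v). u \<in> h i \<and> v \<in> h i \<and> u \<noteq> v} \<rparr>" for i
  have pairs: "\<exists>u v. h i = {u, v} \<and> (u, v) \<in> E \<and> (v, u) \<in> E \<and> u \<noteq> v" if "i < card S" for i
  proof -
    have "h i \<in> S"
      using h that by (auto simp: bij_betw_def)
    then obtain u v where "(u, v) \<in> E" "h i = {u, v}"
      by (auto simp: S_def)
    with E(2,3) show ?thesis
      by (metis irreflD symD)
  qed
  \<comment> \<open>An edge through \<open>x\<close> is determined by \<open>x\<close>, since its
    other end is the unique partner of \<open>x\<close>. Hence distinct edges are disjoint.\<close>
  have eq: "A = A'" if "A \<in> S" "A' \<in> S" "x \<in> A" "x \<in> A'" for A A' x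
  proof -
    have "A = {x, THE v. (x, v) \<in> E}" if "A \<in> S" "x \<in> A" for A
    proof -
      from that E(2) obtain v where v: "A = {x, v}" "(x, v) \<in> E"
        by (auto simp: S_def dest: symD)
      moreover have "(THE v. (x, v) \<in> E) = v"
        using v match E(1) by (intro the1_equality) auto
      ultimately show ?thesis
        by simp
    qed
    with that show ?thesis
      by blast
  qed
  have "complete_digraph 2 (with_proj (C i))" if "i < card S" for i
    using pairs[OF that] by (auto simp: complete_digraph_pair_def C_def)
  moreover have "disjoint_family_on (\<lambda>i. pverts (C i)) {..<card S}"
    unfolding disjoint_family_on_def
  proof (intro ballI impI)
    fix i j assume ij: "i \<in> {..<card S}" "j \<in> {..<card S}" "i \<noteq> j"
    then have "h i \<noteq> h j" "h i \<in> S" "h j \<in> S"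
      using h by (auto simp: bij_betw_def dest: inj_onD)
    then show "pverts (C i) \<inter> pverts (C j) = {}"
      using eq by (auto simp: C_def)
  qed
  moreover have "V = (\<Union>i<card S. pverts (C i))"
  proof -
    have "(\<Union>i<card S. pverts (C i)) = \<Union>S"
      using h by (auto simp: C_def bij_betw_def)
    also have "\<dots> = V"
      using E(1) match by (fastforce simp: S_def)
    finally show ?thesis ..
  qed
  moreover have "E = (\<Union>i<card S. parcs (C i))"
  proof (intro set_eqI iffI; clarify)
    fix u v assume uv: "(u, v) \<in> E"
    then have "{u, v} \<in> S"
      by (auto simp: S_def)
    then obtain i where "i < card S" "h i = {u, v}"
      using h by (metis bij_betw_imp_surj_on imageE lessThan_iff)
    with uv E(3) show "(u, v) \<in> (\<Union>i<card S. parcs (C i))"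
      by (auto simp: C_def dest: irreflD)
  next
    fix u v i assume "i < card S" "(u, v) \<in> parcs (C i)"
    with pairs[of i] show "(u, v) \<in> E"
      by (auto simp: C_def)
  qed
  ultimately show ?thesis
    unfolding disjoint_K2s_def by blast
qed

section \<open>From a tight open packing to the construction of the family\<close>

lemma (in pair_graph) tight_open_packing_imp_Gamma_family:
  assumes conn: "connected (with_proj G)" and B: "open_packing G B"
    and tight: "card B * min_degree G = card (pverts G)" and ne: "pverts G \<noteq> {}"
  shows "G \<in> Gamma_family"
proof -
  have BV: "B \<subseteq> pverts G"
    using B by (simp add: open_packing_def)
  note deg = tight_open_packing(1)[OF B tight]
  have nbr: "\<exists>!u. u \<in> B \<and> (u, v) \<in> parcs G" if "v \<in> pverts G" for v
    using tight_open_packing(2)[OF B tight that] .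
  define E where "E = parcs G \<inter> B \<times> B"
  define H where "H = \<lparr> pverts = B, parcs = E \<rparr>"
  define pn where "pn u = open_nbhd G u - B" for u
  define P where "P = pverts G - B"
  define F where "F = parcs G \<inter> P \<times> P"
  have irr: "(x, x) \<notin> parcs G" for x
    using pair_no_loops by fastforce
  \<comment> \<open>Every vertex has exactly one neighbour in \<open>B\<close>; for members of
    \<open>B\<close> this is a perfect matching inside \<open>B\<close>.\<close>
  have match: "\<exists>!v. (u, v) \<in> E" if "u \<in> B" for u
    using nbr[of u] that BV parcs_sym unfolding E_def by blast
  have "\<exists>t. disjoint_K2s t H"
    unfolding H_def
    by (rule matching_disjoint_K2s)
      (use match finite_open_packing[OF B] irr parcs_sym in \<open>auto simp: E_def sym_def irrefl_def\<close>)
  then obtain t where t: "disjoint_K2s t H" ..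
  \<comment> \<open>With no copies \<open>B\<close> would be empty, yet some vertex exists and needs
    a neighbour in \<open>B\<close>.\<close>
  have "t \<ge> 1"
  proof (rule ccontr)
    assume "\<not> t \<ge> 1"
    then have "B = {}"
      using disjoint_K2s_matching(1,2)[OF t] by (simp add: H_def not_less_eq_eq)
    then show False
      using nbr ne by auto
  qed
  \<comment> \<open>The parameter \<open>k\<close> is the minimum degree less one: exactly one
    neighbour of \<open>u\<close> is its partner in \<open>B\<close>.\<close>
  have "card (pn u) = min_degree G - 1" if u: "u \<in> B" for u
  proof -
    obtain v where "\<And>w. (u, w) \<in> E \<longleftrightarrow> w = v"
      using match[OF u] by blast
    then have "open_nbhd G u \<inter> B = {v}"
      using u by (auto simp: E_def open_nbhd_def)
    then have "pn u = open_nbhd G u - {v}" "v \<in> open_nbhd G u"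
      by (auto simp: pn_def)
    then show ?thesis
      using deg[OF u] finite_open_nbhd by simp
  qed
  then have pn: "\<forall>u\<in>pverts H. finite (pn u) \<and> card (pn u) = min_degree G - 1 \<and> pn u \<inter> pverts H = {}"
    using finite_open_nbhd by (auto simp: H_def pn_def)
  have disj: "disjoint_family_on pn (pverts H)"
    using B by (auto simp: disjoint_family_on_def open_packing_def H_def pn_def)
  \<comment> \<open>A vertex outside \<open>B\<close> lies in \<open>pn u\<close> for its neighbour
    \<open>u\<close> in \<open>B\<close>.\<close>
  have P: "P = (\<Union>u\<in>pverts H. pn u)"
    using nbr in_arcsD2 unfolding P_def H_def pn_def open_nbhd_def by auto blast
  have F: "F \<subseteq> P \<times> P" "sym F" "irrefl F"
    using parcs_sym irr by (auto simp: F_def sym_def irrefl_def)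
  have "parcs G = parcs H \<union> (\<Union>u\<in>pverts H. {u} \<times> pn u \<union> pn u \<times> {u}) \<union> F"
  proof (intro subset_antisym subrelI)
    fix x y assume xy: "(x, y) \<in> parcs G"
    then have "x \<in> B \<union> P" "y \<in> B \<union> P" "(y, x) \<in> parcs G"
      using parcs_sym by (auto simp: P_def dest: in_arcsD1 in_arcsD2)
    with xy show "(x, y) \<in> parcs H \<union> (\<Union>u\<in>pverts H. {u} \<times> pn u \<union> pn u \<times> {u}) \<union> F"
      by (auto simp: H_def E_def F_def P_def pn_def open_nbhd_def)
  next
    fix x y assume "(x, y) \<in> parcs H \<union> (\<Union>u\<in>pverts H. {u} \<times> pn u \<union> pn u \<times> {u}) \<union> F"
    then have "(x, y) \<in> parcs G \<or> (y, x) \<in> parcs G"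
      by (auto simp: H_def E_def F_def pn_def open_nbhd_def)
    then show "(x, y) \<in> parcs G"
      using parcs_sym by blast
  qed
  moreover have "pverts G = pverts H \<union> P"
    using BV by (auto simp: H_def P_def)
  ultimately have G: "G = \<lparr> pverts = pverts H \<union> P,
      parcs = parcs H \<union> (\<Union>u\<in>pverts H. {u} \<times> pn u \<union> pn u \<times> {u}) \<union> F \<rparr>"
    by simp
  \<comment> \<open>Minimum degree 0 would give an empty graph by \<open>tight\<close>. Hence the
    truncated difference \<open>min_degree G - 1\<close> is exact, and adding 1 restores the minimum
    degree.\<close>
  have "min_degree G \<noteq> 0"
    using tight ne pair_finite_verts by (auto simp: card_eq_0_iff)
  then have "\<forall>v\<in>P. out_degree (with_proj G) v \<ge> (min_degree G - 1) + 1"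
    using min_degree_le by (auto simp: P_def out_degree_eq_card_open_nbhd)
  then show ?thesis
    unfolding Gamma_family_def mem_Collect_eq
    using \<open>t \<ge> 1\<close> t pn disj P F G conn
    by (intro exI[of _ t] exI[of _ H] exI[of _ "min_degree G - 1"] exI[of _ pn] exI[of _ P] exI[of _ F] conjI)
qed

section \<open>From the construction of the family to a tight open packing\<close>

lemma (in pair_graph) Gamma_family_imp_tight:
  assumes "G \<in> Gamma_family"
  shows "open_packing_number G * min_degree G = card (pverts G)" "min_degree G > 0"
proof -
  from assms obtain t H k pn P F where
      t: "t \<ge> 1" and H: "disjoint_K2s t H" and
      pn: "\<forall>u\<in>pverts H. finite (pn u) \<and> card (pn u) = k \<and> pn u \<inter> pverts H = {}" and
      disj: "disjoint_family_on pn (pverts H)" and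
      P: "P = (\<Union>u\<in>pverts H. pn u)" and F: "F \<subseteq> P \<times> P" and
      G: "G = \<lparr> pverts = pverts H \<union> P,
           parcs = parcs H \<union> (\<Union>u\<in>pverts H. {u} \<times> pn u \<union> pn u \<times> {u}) \<union> F \<rparr>" and
      degP: "\<forall>v\<in>P. out_degree (with_proj G) v \<ge> k + 1"
    unfolding Gamma_family_def mem_Collect_eq by (elim exE conjE) (rule that; assumption)
  note matching = disjoint_K2s_matching[OF H]
  define B where "B = pverts H"
  have BP: "B \<inter> P = {}"
    using pn by (auto simp: B_def P)
  have pV: "pverts G = B \<union> P" and
       pA: "parcs G = parcs H \<union> (\<Union>u\<in>B. {u} \<times> pn u \<union> pn u \<times> {u}) \<union> F"
    by (simp_all add: G B_def)
  have "\<forall>u\<in>B. \<exists>v. \<forall>w. (u, w) \<in> parcs H \<longleftrightarrow> w = v"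
    using matching(4) unfolding B_def by blast
  then obtain mate where mate: "\<And>u w. u \<in> B \<Longrightarrow> (u, w) \<in> parcs H \<longleftrightarrow> w = mate u"
    by metis
  have mateB: "mate u \<in> B" if "u \<in> B" for u
    using mate[OF that] matching(3) unfolding B_def by blast
  \<comment> \<open>Arcs leaving \<open>B\<close> come from \<open>H\<close> or from
    \<open>{u} \<times> pn u\<close>; all others start in \<open>P\<close>, which is disjoint from
    \<open>B\<close>.\<close>
  have nbhd: "open_nbhd G u = insert (mate u) (pn u)" if "u \<in> B" for u
    using that BP F mate[OF that] unfolding open_nbhd_def pA P B_def[symmetric] by blast
  \<comment> \<open>Arcs of \<open>H\<close> are reversible, so the common mate has both
    \<open>u\<close> and \<open>v\<close> as its mate.\<close>
  have mate_inj: "u = v" if "u \<in> B" "v \<in> B" "mate u = mate v" for u v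
    using that mate mateB matching(5) by metis
  have pack: "open_packing G B"
    unfolding open_packing_def
  proof (intro conjI ballI impI)
    show "B \<subseteq> pverts G"
      by (simp add: pV)
    fix u v assume uv: "u \<in> B" "v \<in> B" "u \<noteq> v"
    \<comment> \<open>Each neighbourhood is a mate plus a set of added vertices, which leaves four
      possible overlaps to exclude.\<close>
    then have "pn u \<inter> pn v = {}"
      using disj by (auto simp: disjoint_family_on_def B_def)
    moreover have "mate u \<noteq> mate v"
      using uv mate_inj by blast
    moreover have "mate u \<notin> pn v" "mate v \<notin> pn u"
      using uv mateB pn by (auto simp: B_def)
    ultimately show "open_nbhd G u \<inter> open_nbhd G v = {}"
      using uv by (auto simp: nbhd)
  qed
  have degB: "card (open_nbhd G u) = k + 1" if "u \<in> B" for u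
  proof -
    have "finite (pn u)" "card (pn u) = k" "mate u \<notin> pn u"
      using that pn mateB by (auto simp: B_def)
    then show ?thesis
      by (simp add: nbhd[OF that])
  qed
  have cardB: "card B = 2 * t"
    using matching(2) by (simp add: B_def)
  obtain u where "u \<in> B"
    using cardB t by fastforce
  then have "min_degree G \<le> k + 1"
    using min_degree_le[of u] degB pV by auto
  \<comment> \<open>Members of \<open>B\<close> have degree exactly \<open>k + 1\<close>; for
    \<open>P\<close> the bound is the degree condition of the family.\<close>
  moreover have "min_degree G \<ge> k + 1"
    unfolding min_degree_def using pair_finite_verts \<open>u \<in> B\<close> degB degP
    by (subst Min_ge_iff) (auto simp: pV out_degree_eq_card_open_nbhd)
  ultimately have md: "min_degree G = k + 1"
    by simp
  then show "min_degree G > 0"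
    by simp
  have "(\<Union>u\<in>B. open_nbhd G u) = pverts G"
  proof
    show "pverts G \<subseteq> (\<Union>u\<in>B. open_nbhd G u)"
    proof
      fix v assume "v \<in> pverts G"
      \<comment> \<open>A vertex of \<open>B\<close> is covered by its mate, an added vertex by the
        vertex it was attached to.\<close>
      then consider "v \<in> B" | u where "u \<in> B" "v \<in> pn u"
        by (auto simp: pV P B_def)
      then show "v \<in> (\<Union>u\<in>B. open_nbhd G u)"
      proof cases
        case 1
        then have "mate (mate v) = v"
          using mate mateB matching(5) by metis
        with 1 show ?thesis
          using mateB nbhd by (metis UN_I insertI1)
      qed (auto simp: nbhd)
    qed
  qed (use open_nbhd_subset in auto)
  then have "card B * min_degree G = card (pverts G)"
    using open_packing_sum_degrees[OF pack] degB md by simp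
  \<comment> \<open>\<open>B\<close> attains the general upper bound
    \<open>open_packing_number_mult_min_degree_le\<close>, so the packing number attains it
    too.\<close>
  moreover have "card B * min_degree G \<le> open_packing_number G * min_degree G"
    using card_le_open_packing_number[OF pack] by simp
  ultimately show "open_packing_number G * min_degree G = card (pverts G)"
    using open_packing_number_mult_min_degree_le by simp
qed

section \<open>Passage between the product equation and the real quotient\<close>

theorem theorem3:
  fixes G :: "'a pair_pre_digraph" and n :: nat
  assumes "pair_graph G"
    and "connected (with_proj G)"
    and "n = card (pverts G)"
    and "n \<ge> 2"
  shows "real (open_packing_number G) = real n / real (min_degree G) \<longleftrightarrow> G \<in> Gamma_family"
proof -
  interpret pair_graph G
    by fact
  have ne: "pverts G \<noteq> {}"
    using assms(3,4) by auto
  show ?thesis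
  proof
    assume eq: "real (open_packing_number G) = real n / real (min_degree G)"
    obtain v where "v \<in> pverts G"
      using ne by auto
    \<comment> \<open>A singleton is vacuously an open packing, so the packing number is
      positive.\<close>
    then have "open_packing G {v}"
      by (simp add: open_packing_def)
    then have "open_packing_number G \<ge> 1"
      using card_le_open_packing_number by force
    \<comment> \<open>since \<open>n / 0 = 0\<close>, this excludes minimum degree 0\<close>
    then have "min_degree G \<noteq> 0"
      using eq by (metis div_by_0 of_nat_0 of_nat_eq_0_iff not_one_le_zero)
    then have "real (open_packing_number G * min_degree G) = real n"
      using eq by simp
    then have tight: "open_packing_number G * min_degree G = card (pverts G)"
      using assms(3) by (simp only: of_nat_eq_iff)
    obtain B where "open_packing G B" "card B = open_packing_number G"
      by (rule open_packing_number_attained)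
    with tight ne assms(2) show "G \<in> Gamma_family"
      by (metis tight_open_packing_imp_Gamma_family)
  next
    assume "G \<in> Gamma_family"
    note tight = Gamma_family_imp_tight[OF this]
    then have "real n = real (open_packing_number G) * real (min_degree G)"
      using assms(3) by (metis of_nat_mult)
    then show "real (open_packing_number G) = real n / real (min_degree G)"
      using tight(2) by simp
  qed
qed

end
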